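(* The non-conservative terms of the reformulated OFTT-Euler system $$\frac{\partial \mathbf U}{\partial t}+\frac{\partial \mathbf f_{x}}{\partial x} + \frac{\partial \mathbf f_{y}}{\partial y} + \mathbf C_{x}(\mathbf U)\frac{\partial \mathbf U}{\partial x} + \mathbf C_{y}(\mathbf U)\frac{\partial \mathbf U}{\partial y}=0$$ do not contribute to the entropy evolution, i.e. for $\mathbf U\in\Omega$ the coefficient matrices $\mathbf C_x(\mathbf U)$ and $\mathbf C_y(\mathbf U)$ satisfy $$\boldsymbol{\mathcal V}^\top\mathbf C_x(\mathbf U)=\boldsymbol{\mathcal V}^\top\mathbf C_y(\mathbf U)=0,$$ where $\boldsymbol{\mathcal V}=\partial\mathcal E/\partial\mathbf U$ is the entropy variable.
   Context: Constants $\gamma_e>1$, $\gamma_i>1$. $\mathbf U=(\rho,\rho v_x,\rho v_y,E,p_i)^\top$, $\boldsymbol v=(v_x,v_y)$, with $p_e$ determined by $E=\frac{p_e}{\gamma_e-1}+\frac{p_i}{\gamma_i-1}+\frac{\rho|\boldsymbol v|^2}{2}$. Admissible set $\Omega=\{\mathbf U\in\mathbb R^5:\rho>0,\ p_e>0,\ p_i>0\}$. Fluxes: $\mathbf f_x=(\rho v_x,\ \rho v_x^2+2p_e,\ \rho v_xv_y,\ (E+2p_e)v_x,\ p_iv_x)^\top$, $\mathbf f_y=(\rho v_y,\ \rho v_xv_y,\ \rho v_y^2+2p_e,\ (E+2p_e)v_y,\ p_iv_y)^\top$. Matrices: $$\mathbf C_x(\mathbf U)=\begin{pmatrix} 0&0&0&0&0\\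 -\frac{(\gamma_e-1)|\boldsymbol v|^2}{2}&(\gamma_e-1)v_x&(\gamma_e-1)v_y&-(\gamma_e-1)&\frac{\gamma_e-1}{\gamma_i-1}+1\\ 0&0&0&0&0\\ -\left(\frac{(\gamma_e-1)|\boldsymbol v|^2}{2}+\frac{p_i-p_e}{\rho}\right)v_x&(\gamma_e-1)v_x^2+\frac{p_i-p_e}{\rho}&(\gamma_e-1)v_xv_y&-(\gamma_e-1)v_x&\left(\frac{\gamma_e-1}{\gamma_i-1}+1\right)v_x\\ -\frac{(\gamma_i-1)p_iv_x}{\rho}&\frac{(\gamma_i-1)p_i}{\rho}&0&0&0\end{pmatrix},$$ $$\mathbf C_y(\mathbf U)=\begin{pmatrix} 0&0&0&0&0\\ 0&0&0&0&0\\ -\frac{(\gamma_e-1)|\boldsymbol v|^2}{2}&(\gamma_e-1)v_x&(\gamma_e-1)v_y&-(\gamma_e-1)&\frac{\gamma_e-1}{\gamma_i-1}+1\\ -\left(\frac{(\gamma_e-1)|\boldsymbol v|^2}{2}+\frac{p_i-p_e}{\rho}\right)v_y&(\gamma_e-1)v_xv_y&(\gamma_e-1)v_y^2+\frac{p_i-p_e}{\rho}&-(\gamma_e-1)v_y&\left(\frac{\gamma_e-1}{\gamma_i-1}+1\right)v_y\\ -\frac{(\gamma_i-1)p_iv_y}{\rho}&0&\frac{(\gamma_i-1)p_i}{\rho}&0&0\end{pmatrix}.$$ The entropy is $\mathcal E=-\rho s$ with $s=\frac{1}{\gamma_e-1}\ln\frac{p_e}{\rho^{\gamma_e}}+\frac1{\gamma_i-1}\ln\frac{p_i}{\rho^{\gamma_i}}$,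 and, with $\beta_e=\rho/p_e$, $\beta_i=\rho/p_i$, the entropy variable is $$\boldsymbol{\mathcal V}=\Big(\tfrac{\gamma_e}{\gamma_e-1}+\tfrac{\gamma_i}{\gamma_i-1}-s-\tfrac{\beta_e|\boldsymbol v|^2}{2},\ \beta_ev_x,\ \beta_ev_y,\ -\beta_e,\ \tfrac{\beta_e-\beta_i}{\gamma_i-1}\Big)^\top.$$ *)

theory Defs
  imports "HOL-Analysis.Analysis"
begin

text \<open>
  A state \<^term>\<open>U :: real^5\<close> holds the conservative variables
  $(\rho, \rho v_x, \rho v_y, E, p_i)$, in this order; everything else is a function of \<open>U\<close>.
  The parameters \<open>ge\<close> and \<open>gi\<close> are the adiabatic constants $\gamma_e$ and $\gamma_i$.
\<close>

definition rho :: "real^5 \<Rightarrow> real" where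
  "rho U = U $ 1"

definition vx :: "real^5 \<Rightarrow> real" where
  "vx U = U $ 2 / U $ 1"

definition vy :: "real^5 \<Rightarrow> real" where
  "vy U = U $ 3 / U $ 1"

definition energy :: "real^5 \<Rightarrow> real" where
  "energy U = U $ 4"

definition p_i :: "real^5 \<Rightarrow> real" where
  "p_i U = U $ 5"

definition vsq :: "real^5 \<Rightarrow> real" where
  "vsq U = (vx U)\<^sup>2 + (vy U)\<^sup>2"

text \<open>The equation of state
  $E = \frac{p_e}{\gamma_e-1} + \frac{p_i}{\gamma_i-1} + \frac{\rho|v|^2}{2}$ solved for $p_e$.\<close>

definition p_e :: "real \<Rightarrow> real \<Rightarrow> real^5 \<Rightarrow> real" where
  "p_e ge gi U = (ge - 1) * (energy U - p_i U / (gi - 1) - rho U * vsq U / 2)"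

definition admissible :: "real \<Rightarrow> real \<Rightarrow> (real^5) set" where
  "admissible ge gi = {U. rho U > 0 \<and> p_e ge gi U > 0 \<and> p_i U > 0}"

definition flux_x :: "real \<Rightarrow> real \<Rightarrow> real^5 \<Rightarrow> real^5" where
  "flux_x ge gi U = vector
    [rho U * vx U,
     rho U * (vx U)\<^sup>2 + 2 * p_e ge gi U,
     rho U * vx U * vy U,
     (energy U + 2 * p_e ge gi U) * vx U,
     p_i U * vx U]"

definition flux_y :: "real \<Rightarrow> real \<Rightarrow> real^5 \<Rightarrow> real^5" where
  "flux_y ge gi U = vector
    [rho U * vy U,
     rho U * vx U * vy U,
     rho U * (vy U)\<^sup>2 + 2 * p_e ge gi U,
     (energy U + 2 * p_e ge gi U) * vy U,
     p_i U * vy U]"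

definition C_x :: "real \<Rightarrow> real \<Rightarrow> real^5 \<Rightarrow> real^5^5" where
  "C_x ge gi U = vector
    [vector [0, 0, 0, 0, 0],
     vector
      [- ((ge - 1) * vsq U / 2),
       (ge - 1) * vx U,
       (ge - 1) * vy U,
       - (ge - 1),
       (ge - 1) / (gi - 1) + 1],
     vector [0, 0, 0, 0, 0],
     vector
      [- (((ge - 1) * vsq U / 2 + (p_i U - p_e ge gi U) / rho U) * vx U),
       (ge - 1) * (vx U)\<^sup>2 + (p_i U - p_e ge gi U) / rho U,
       (ge - 1) * vx U * vy U,
       - ((ge - 1) * vx U),
       ((ge - 1) / (gi - 1) + 1) * vx U],
     vector
      [- ((gi - 1) * p_i U * vx U / rho U),
       (gi - 1) * p_i U / rho U,
       0, 0, 0]]"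

definition C_y :: "real \<Rightarrow> real \<Rightarrow> real^5 \<Rightarrow> real^5^5" where
  "C_y ge gi U = vector
    [vector [0, 0, 0, 0, 0],
     vector [0, 0, 0, 0, 0],
     vector
      [- ((ge - 1) * vsq U / 2),
       (ge - 1) * vx U,
       (ge - 1) * vy U,
       - (ge - 1),
       (ge - 1) / (gi - 1) + 1],
     vector
      [- (((ge - 1) * vsq U / 2 + (p_i U - p_e ge gi U) / rho U) * vy U),
       (ge - 1) * vx U * vy U,
       (ge - 1) * (vy U)\<^sup>2 + (p_i U - p_e ge gi U) / rho U,
       - ((ge - 1) * vy U),
       ((ge - 1) / (gi - 1) + 1) * vy U],
     vector
      [- ((gi - 1) * p_i U * vy U / rho U),
       0,
       (gi - 1) * p_i U / rho U,
       0, 0]]"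

definition spec_entropy :: "real \<Rightarrow> real \<Rightarrow> real^5 \<Rightarrow> real" where
  "spec_entropy ge gi U =
     1 / (ge - 1) * ln (p_e ge gi U / rho U powr ge) +
     1 / (gi - 1) * ln (p_i U / rho U powr gi)"

definition entropy :: "real \<Rightarrow> real \<Rightarrow> real^5 \<Rightarrow> real" where
  "entropy ge gi U = - rho U * spec_entropy ge gi U"

definition beta_e :: "real \<Rightarrow> real \<Rightarrow> real^5 \<Rightarrow> real" where
  "beta_e ge gi U = rho U / p_e ge gi U"

definition beta_i :: "real^5 \<Rightarrow> real" where
  "beta_i U = rho U / p_i U"

definition entropy_var :: "real \<Rightarrow> real \<Rightarrow> real^5 \<Rightarrow> real^5" where
  "entropy_var ge gi U = vector
    [ge / (ge - 1) + gi / (gi - 1) - spec_entropy ge gi U - beta_e ge gi U * vsq U / 2,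
     beta_e ge gi U * vx U,
     beta_e ge gi U * vy U,
     - beta_e ge gi U,
     (beta_e ge gi U - beta_i U) / (gi - 1)]"

text \<open>
  \<open>W t x y\<close> satisfies the reformulated OFTT-Euler system at the point \<open>(t, x, y)\<close> in the classical
  sense. Differentiability of the fluxes along \<open>W\<close> is not required separately: they are smooth
  functions of the state wherever $\rho \neq 0$.
\<close>

definition oftt_euler_at ::
  "real \<Rightarrow> real \<Rightarrow> (real \<Rightarrow> real \<Rightarrow> real \<Rightarrow> real^5) \<Rightarrow> real \<Rightarrow> real \<Rightarrow> real \<Rightarrow> bool" where
  "oftt_euler_at ge gi W t x y \<longleftrightarrow>
     (\<lambda>t'. W t' x y) differentiable at t \<and>
     (\<lambda>x'. W t x' y) differentiable at x \<and>
     (\<lambda>y'. W t x y') differentiable at y \<and>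
     vector_derivative (\<lambda>t'. W t' x y) (at t)
       + vector_derivative (\<lambda>x'. flux_x ge gi (W t x' y)) (at x)
       + vector_derivative (\<lambda>y'. flux_y ge gi (W t x y')) (at y)
       + C_x ge gi (W t x y) *v vector_derivative (\<lambda>x'. W t x' y) (at x)
       + C_y ge gi (W t x y) *v vector_derivative (\<lambda>y'. W t x y') (at y) = 0"

end

theory Submission
  imports Defs
begin

text \<open>
  Of the three quantities in the entropy, $\rho$ and $p_i$ are coordinates of the state, and $p_e$
  depends on it nonlinearly only through the kinetic energy $|m|^2/(2\rho)$, with momentum
  $m = \rho v$, whose differential is $v \cdot dm - \frac{1}{2}|v|^2\,d\rho$
  (\<open>has_derivative_kinetic_energy\<close>). Substituting the resulting $dp_e$ into
  \[ d(-\rho s) = \Bigl(\frac{\gamma_e}{\gamma_e-1} + \frac{\gamma_i}{\gamma_i-1} - s\Bigr) d\rho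
       - \frac{\beta_e}{\gamma_e-1}\,dp_e - \frac{\beta_i}{\gamma_i-1}\,dp_i \]
  (\<open>has_derivative_entropy\<close>) and collecting the coefficients gives the entropy variable.

  The non-conservative terms cancel for the following reason. The second row of $C_x$ is the
  gradient of $p_i - p_e$, and the energy row contains $v_x$ times it; in the product with the
  entropy variable they carry the weights $\beta_e v_x$ and $-\beta_e$, so these parts cancel.
  What remains of the energy row is the work term $-\beta_e (p_i - p_e)\,(-v_x, 1)/\rho$ in the
  first two columns, and the $p_i$ row contributes $(\beta_e - \beta_i)\, p_i\,(-v_x, 1)/\rho$.
  These are opposite because $\beta_e p_e = \beta_i p_i = \rho$ (\<open>beta_pressure_balance\<close>).
  For $C_y$ the same happens with $v_y$ and the third row and column.

  The evolution law follows from the chain rule: pairing the system with the entropy variable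
  kills the two non-conservative terms and turns the time derivative of the state into that of
  the entropy.
\<close>

lemma exhaust_5:
  fixes x :: 5
  shows "x = 1 \<or> x = 2 \<or> x = 3 \<or> x = 4 \<or> x = 5"
proof (induct x)
  case (of_int z)
  then have "z = 0 \<or> z = 1 \<or> z = 2 \<or> z = 3 \<or> z = 4" by fastforce
  then show ?case by auto
qed

lemma forall_5: "(\<forall>i::5. P i) \<longleftrightarrow> P 1 \<and> P 2 \<and> P 3 \<and> P 4 \<and> P 5"
  by (metis exhaust_5)

lemma UNIV_5: "UNIV = {1, 2, 3, 4, 5::5}"
  using exhaust_5 by auto

lemma sum_5: "sum f (UNIV::5 set) = f 1 + f 2 + f 3 + f 4 + f 5"
  unfolding UNIV_5 by (simp add: ac_simps)

lemma vector_5 [simp]: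
  "(vector [a,b,c,d,e] :: 'a::zero^5) $ 1 = a"
  "(vector [a,b,c,d,e] :: 'a::zero^5) $ 2 = b"
  "(vector [a,b,c,d,e] :: 'a::zero^5) $ 3 = c"
  "(vector [a,b,c,d,e] :: 'a::zero^5) $ 4 = d"
  "(vector [a,b,c,d,e] :: 'a::zero^5) $ 5 = e"
  unfolding vector_def by simp_all

text \<open>
  This is the differential of $\ln f - c \ln r$. Stating it for the quotient makes it applicable
  to the specific entropy as it is written, without splitting the logarithm in a neighbourhood.
\<close>

lemma has_derivative_ln_divide_powr:
  fixes f r :: "'a::real_normed_vector \<Rightarrow> real"
  assumes f: "(f has_derivative f') (at x)" and r: "(r has_derivative r') (at x)"
    and pos: "f x > 0" "r x > 0"
  shows "((\<lambda>y. ln (f y / r y powr c)) has_derivative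
           (\<lambda>h. f' h / f x - c * r' h / r x)) (at x)"
proof -
  have "((\<lambda>y. r y powr c) has_derivative (\<lambda>h. r x powr c * (c * r' h / r x))) (at x)"
    using pos by (auto intro!: derivative_eq_intros f r simp: field_simps)
  note quotient = has_derivative_divide[OF f this]
  have "((\<lambda>y. ln (f y / r y powr c)) has_derivative
      (\<lambda>h. (- f x * (inverse (r x powr c) * (r x powr c * (c * r' h / r x)) * inverse (r x powr c))
          + f' h / r x powr c) * inverse (f x / r x powr c))) (at x)"
    by (rule has_derivative_ln[OF _ quotient]) (use pos in auto)
  moreover have "(- f x * (inverse (r x powr c) * (r x powr c * (c * r' h / r x)) * inverse (r x powr c))
          + f' h / r x powr c) * inverse (f x / r x powr c) = f' h / f x - c * r' h / r x" for h
    using pos by (simp add: field_simps)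
  ultimately show ?thesis by simp
qed

lemma has_derivative_vec_nth: "((\<lambda>U. U $ i) has_derivative (\<lambda>h. h $ i)) (at (U :: real^'n))"
  by (rule bounded_linear_imp_has_derivative[OF bounded_linear_vec_nth])

lemma has_derivative_kinetic_energy:
  assumes "rho U > 0"
  shows "((\<lambda>U. rho U * vsq U / 2) has_derivative
           (\<lambda>h. vx U * h $ 2 + vy U * h $ 3 - vsq U / 2 * h $ 1)) (at U)"
proof -
  have nz: "U $ 1 \<noteq> 0" using assms by (simp add: rho_def)
  have square: "((\<lambda>U. (U $ i / U $ 1)\<^sup>2) has_derivative
      (\<lambda>h. 2 * (U $ i / U $ 1) * ((h $ i * U $ 1 - U $ i * h $ 1) / (U $ 1 * U $ 1)))) (at U)" for i
    using has_derivative_power[OF has_derivative_divide'[OF has_derivative_vec_nth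
          has_derivative_vec_nth nz, of i], of 2]
    by (rule has_derivative_subst) (simp add: fun_eq_iff algebra_simps diff_divide_distrib)
  show ?thesis
    unfolding rho_def vsq_def vx_def vy_def divide_inverse[of _ 2]
    by (rule has_derivative_subst[OF has_derivative_mult_left[OF has_derivative_mult[OF
            has_derivative_vec_nth has_derivative_add[OF square square]]]])
      (use nz in \<open>simp add: fun_eq_iff field_simps power2_eq_square\<close>)
qed

lemma has_derivative_p_e:
  assumes "rho U > 0"
  shows "(p_e ge gi has_derivative
           (\<lambda>h. (ge - 1) * (h $ 4 - h $ 5 / (gi - 1)
                 - (vx U * h $ 2 + vy U * h $ 3 - vsq U / 2 * h $ 1)))) (at U)"
proof -
  have "((\<lambda>U. p_i U / (gi - 1)) has_derivative (\<lambda>h. h $ 5 / (gi - 1))) (at U)"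
    unfolding p_i_def divide_inverse
    by (intro has_derivative_mult_left has_derivative_vec_nth)
  then show ?thesis
    unfolding p_e_def[abs_def] energy_def
    by (intro has_derivative_mult_right has_derivative_diff has_derivative_vec_nth
        has_derivative_kinetic_energy assms)
qed

lemma has_derivative_entropy:
  assumes "rho U > 0" "p_e ge gi U > 0" "p_i U > 0"
    and pe': "(p_e ge gi has_derivative pe') (at U)"
  shows "(entropy ge gi has_derivative
           (\<lambda>h. (ge / (ge - 1) + gi / (gi - 1) - spec_entropy ge gi U) * h $ 1
                - beta_e ge gi U / (ge - 1) * pe' h - beta_i U / (gi - 1) * h $ 5)) (at U)"
proof -
  have rho: "(rho has_derivative (\<lambda>h. h $ 1)) (at U)"
    and p_i: "(p_i has_derivative (\<lambda>h. h $ 5)) (at U)"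
    unfolding rho_def[abs_def] p_i_def[abs_def] by (rule has_derivative_vec_nth)+
  have "(spec_entropy ge gi has_derivative
      (\<lambda>h. 1 / (ge - 1) * (pe' h / p_e ge gi U - ge * h $ 1 / rho U)
         + 1 / (gi - 1) * (h $ 5 / p_i U - gi * h $ 1 / rho U))) (at U)"
    unfolding spec_entropy_def[abs_def]
    by (intro has_derivative_add has_derivative_mult_right has_derivative_ln_divide_powr
        pe' rho p_i assms)
  note deriv = has_derivative_mult[OF has_derivative_minus[OF rho] this]
  \<comment> \<open>Only the denominators \<open>\<rho>\<close>, \<open>p\<^sub>e\<close> and \<open>p\<^sub>i\<close> have to be cleared; \<open>a\<close> and \<open>b\<close> hide the
    constant ones, so that clearing denominators leaves a polynomial identity.\<close>
  define a b where "a = 1 / (ge - 1)" and "b = 1 / (gi - 1)"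
  have ab: "z / (ge - 1) = z * a" "z / (gi - 1) = z * b" for z
    by (simp_all add: a_def b_def)
  show ?thesis
    unfolding entropy_def[abs_def] beta_e_def beta_i_def
    by (rule has_derivative_subst[OF deriv], unfold ab)
      (use assms in \<open>simp add: fun_eq_iff field_simps\<close>)
qed

theorem gderiv_entropy:
  assumes "ge > 1" "U \<in> admissible ge gi"
  shows "GDERIV (entropy ge gi) U :> entropy_var ge gi U"
proof -
  have pos: "rho U > 0" "p_e ge gi U > 0" "p_i U > 0"
    using assms(2) by (auto simp: admissible_def)
  have cancel: "beta_e ge gi U / (ge - 1) * ((ge - 1) * z) = beta_e ge gi U * z" for z
    using assms(1) by simp
  show ?thesis
    unfolding gderiv_def
    by (rule has_derivative_subst[OF has_derivative_entropy[OF pos has_derivative_p_e[OF pos(1)]]],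
        unfold cancel)
      (simp add: fun_eq_iff entropy_var_def inner_vec_def sum_5 algebra_simps diff_divide_distrib)
qed

text \<open>
  The work term of the energy equation and the $p_i$ equation enter with opposite signs; both
  sides here equal $\rho\,(p_i/p_e - 1)$.
\<close>

lemma beta_pressure_balance:
  assumes "U \<in> admissible ge gi"
  shows "beta_e ge gi U * (p_i U - p_e ge gi U) = (beta_e ge gi U - beta_i U) * p_i U"
  using assms by (simp add: admissible_def beta_e_def beta_i_def field_simps)

lemma entropy_var_C_x:
  assumes "gi > 1" "U \<in> admissible ge gi"
  shows "entropy_var ge gi U v* C_x ge gi U = 0"
proof -
  have "gi - 1 \<noteq> 0" "rho U \<noteq> 0" using assms by (auto simp: admissible_def)
  then show ?thesis
    using beta_pressure_balance[OF assms(2)]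
    by (simp add: vec_eq_iff forall_5 vector_matrix_mult_def sum_5 entropy_var_def C_x_def)
      (simp add: field_simps power2_eq_square; algebra)
qed

lemma entropy_var_C_y:
  assumes "gi > 1" "U \<in> admissible ge gi"
  shows "entropy_var ge gi U v* C_y ge gi U = 0"
proof -
  have "gi - 1 \<noteq> 0" "rho U \<noteq> 0" using assms by (auto simp: admissible_def)
  then show ?thesis
    using beta_pressure_balance[OF assms(2)]
    by (simp add: vec_eq_iff forall_5 vector_matrix_mult_def sum_5 entropy_var_def C_y_def)
      (simp add: field_simps power2_eq_square; algebra)
qed

theorem lemmaA1:
  fixes ge gi :: real and U :: "real^5"
  assumes "ge > 1" and "gi > 1"
    and "U \<in> admissible ge gi"
  shows "GDERIV (entropy ge gi) U :> entropy_var ge gi U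
    \<and> entropy_var ge gi U v* C_x ge gi U = 0
    \<and> entropy_var ge gi U v* C_y ge gi U = 0
    \<and> (\<forall>W t x y. W t x y = U \<and> oftt_euler_at ge gi W t x y \<longrightarrow>
         ((\<lambda>t'. entropy ge gi (W t' x y)) has_real_derivative
            - (entropy_var ge gi U \<bullet> vector_derivative (\<lambda>x'. flux_x ge gi (W t x' y)) (at x)
             + entropy_var ge gi U \<bullet> vector_derivative (\<lambda>y'. flux_y ge gi (W t x y')) (at y))) (at t))"
proof (intro conjI allI impI)
  let ?V = "entropy_var ge gi U"
  show gradient: "GDERIV (entropy ge gi) U :> ?V"
    by (rule gderiv_entropy[OF assms(1,3)])
  show C_x: "?V v* C_x ge gi U = 0" and C_y: "?V v* C_y ge gi U = 0"
    using assms by (auto intro: entropy_var_C_x entropy_var_C_y)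
  fix W t x y
  assume *: "W t x y = U \<and> oftt_euler_at ge gi W t x y"
  define w where "w = vector_derivative (\<lambda>t'. W t' x y) (at t)"
  define wx where "wx = vector_derivative (\<lambda>x'. W t x' y) (at x)"
  define wy where "wy = vector_derivative (\<lambda>y'. W t x y') (at y)"
  define fx where "fx = vector_derivative (\<lambda>x'. flux_x ge gi (W t x' y)) (at x)"
  define fy where "fy = vector_derivative (\<lambda>y'. flux_y ge gi (W t x y')) (at y)"
  have w: "((\<lambda>t'. W t' x y) has_derivative (\<lambda>h. h *\<^sub>R w)) (at t)"
    and system: "w + fx + fy + C_x ge gi U *v wx + C_y ge gi U *v wy = 0"
    using * by (auto simp: oftt_euler_at_def w_def wx_def wy_def fx_def fy_def
        vector_derivative_works has_vector_derivative_def)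
  have "?V \<bullet> (C_x ge gi U *v wx) = 0" "?V \<bullet> (C_y ge gi U *v wy) = 0"
    by (simp_all flip: dot_lmul_matrix add: C_x C_y)
  with arg_cong[OF system, of "inner ?V"] have "?V \<bullet> w = - (?V \<bullet> fx + ?V \<bullet> fy)"
    by (simp add: inner_add_right)
  moreover have "(entropy ge gi has_derivative (\<lambda>h. h \<bullet> ?V)) (at (W t x y))"
    using gradient * by (simp add: gderiv_def)
  from has_derivative_compose[OF w this]
  have "((\<lambda>t'. entropy ge gi (W t' x y)) has_real_derivative ?V \<bullet> w) (at t)"
    unfolding has_field_derivative_def
    by (rule has_derivative_subst) (simp add: fun_eq_iff inner_commute mult.commute)
  ultimately show "((\<lambda>t'. entropy ge gi (W t' x y)) has_real_derivative
      - (?V \<bullet> vector_derivative (\<lambda>x'. flux_x ge gi (W t x' y)) (at x)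
       + ?V \<bullet> vector_derivative (\<lambda>y'. flux_y ge gi (W t x y')) (at y))) (at t)"
    by (simp add: fx_def fy_def)
qed

end
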